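(* The map sending a pair of bi-infinite paths $(u_i)_{i\in\mathbb{Z}}$, $(v_j)_{j\in\mathbb{Z}}$ in $\mathcal{T}$, with chosen normalisations $u_i=p_i/q_i$ and $v_j=r_j/s_j$, to the equivalence class of the matrix $(m_{i,j})_{i,j\in\mathbb{Z}}$, $m_{i,j}=p_is_j-q_ir_j$, provides a (well-defined) bijection between equivalence classes of tame $SL_2(\mathbb{Z}[\sigma])$-tilings and pairs of bi-infinite paths in $\mathcal{T}$ considered up to the simultaneous action of $SL_2(\mathbb{Z}[\sigma])$ on both paths.
   Context: Let $\sigma=e^{i\pi/3}$, $\mathbb{Z}[\sigma]$ the Eisenstein integers, $\widehat{\mathbb{Q}}(\sigma)=\mathbb{Q}(\sigma)\cup\{\infty\}$. A fraction $p/q$ ($p,q\in\mathbb{Z}[\sigma]$, not both zero) is irreducible if every common factor $k\in\mathbb{Z}[\sigma]$ of $p,q$ has $|k|=1$. $\mathcal{T}$ is the graph with vertex set $\widehat{\mathbb{Q}}(\sigma)$ in which points with irreducible representations $p/q$, $r/s$ are adjacent iff $|ps-rq|=1$ (the edges of the tiling of $\mathbb{H}^3$ by the images of the regular ideal tetrahedron with vertices $0,1,\sigma,\infty$ under its reflection group). A bi-infinite path is a sequence $(v_i)_{i\in\mathbb{Z}}$ of vertices with $v_i,v_{i+1}$ adjacent; a normalisation of it is a choice of irreducible fractions $v_i=p_i/q_i$ with $p_iq_{i+1}-p_{i+1}q_i=1$ for all $i$ (each path has exactly six normalisations, differing by multiplying $p_i,q_i$ by $\sigma^{(-1)^ik}$).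 $SL_2(\mathbb{Z}[\sigma])$ acts on $\widehat{\mathbb{Q}}(\sigma)$ by Möbius transformations, preserving $\mathcal{T}$. A bi-infinite matrix $(m_{i,j})$ over $\mathbb{Z}[\sigma]$ is an $SL_2(\mathbb{Z}[\sigma])$-tiling if $m_{i,j}m_{i+1,j+1}-m_{i,j+1}m_{i+1,j}=1$ for all $i,j$, and tame if all $3\times3$ determinants $\det(m_{i+a,j+b})_{a,b=0,1,2}$ vanish. Two tilings $(m_{i,j})$, $(m'_{i,j})$ are equivalent if there are integers $k,l$ with $m'_{i,j}=\sigma^{(-1)^ik+(-1)^jl}m_{i,j}$ for all $i,j$ (even rows multiplied by $\sigma^k$, odd rows by $\sigma^{-k}$, even columns by $\sigma^l$, odd columns by $\sigma^{-l}$). *)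

theory Defs
  imports "HOL-Analysis.Analysis"
begin

definition \<sigma> :: complex where
  "\<sigma> = exp (\<i> * of_real pi / 3)"

definition eisenstein_ints :: "complex set" where
  "eisenstein_ints = {of_int a + of_int b * \<sigma> | a b. True}"

definition eisenstein_rats :: "complex set" where
  "eisenstein_rats = {of_rat a + of_rat b * \<sigma> | a b. True}"

text \<open>The point at infinity is \<^term>\<open>None\<close>.\<close>

definition extended_eisenstein_rats :: "complex option set" where
  "extended_eisenstein_rats = insert None (Some ` eisenstein_rats)"

definition fraction :: "complex \<Rightarrow> complex \<Rightarrow> complex option" where
  "fraction p q = (if q = 0 then None else Some (p / q))"

text \<open>Divisibility has to be taken inside the ring of Eisenstein integers: the relation
  \<open>dvd\<close> of the field \<^typ>\<open>complex\<close> is trivial.\<close>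

definition common_factor :: "complex \<Rightarrow> complex \<Rightarrow> complex \<Rightarrow> bool" where
  "common_factor k p q \<longleftrightarrow> k \<in> eisenstein_ints \<and>
     (\<exists>a\<in>eisenstein_ints. p = k * a) \<and> (\<exists>b\<in>eisenstein_ints. q = k * b)"

definition irreducible_fraction :: "complex \<Rightarrow> complex \<Rightarrow> bool" where
  "irreducible_fraction p q \<longleftrightarrow>
     p \<in> eisenstein_ints \<and> q \<in> eisenstein_ints \<and> \<not> (p = 0 \<and> q = 0) \<and>
     (\<forall>k. common_factor k p q \<longrightarrow> cmod k = 1)"

text \<open>The graph \<open>\<T>\<close>. Irreducible representations are unique up to a common unit factor, so
  the choice of representations is immaterial.\<close>

definition adjacent :: "complex option \<Rightarrow> complex option \<Rightarrow> bool" where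
  "adjacent x y \<longleftrightarrow> x \<in> extended_eisenstein_rats \<and> y \<in> extended_eisenstein_rats \<and>
     (\<exists>p q r s. irreducible_fraction p q \<and> irreducible_fraction r s \<and>
        x = fraction p q \<and> y = fraction r s \<and> cmod (p * s - r * q) = 1)"

definition bi_infinite_path :: "(int \<Rightarrow> complex option) \<Rightarrow> bool" where
  "bi_infinite_path v \<longleftrightarrow>
     (\<forall>i. v i \<in> extended_eisenstein_rats) \<and> (\<forall>i. adjacent (v i) (v (i + 1)))"

definition normalisation ::
  "(int \<Rightarrow> complex option) \<Rightarrow> (int \<Rightarrow> complex) \<Rightarrow> (int \<Rightarrow> complex) \<Rightarrow> bool" where
  "normalisation v p q \<longleftrightarrow>
     (\<forall>i. irreducible_fraction (p i) (q i) \<and> v i = fraction (p i) (q i)) \<and>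
     (\<forall>i. p i * q (i + 1) - p (i + 1) * q i = 1)"

definition SL2_eisenstein :: "(complex^2^2) set" where
  "SL2_eisenstein = {A. (\<forall>i j. A $ i $ j \<in> eisenstein_ints) \<and> det A = 1}"

definition mobius :: "complex^2^2 \<Rightarrow> complex option \<Rightarrow> complex option" where
  "mobius A x = (case x of
       None \<Rightarrow> fraction (A $ 1 $ 1) (A $ 2 $ 1)
     | Some z \<Rightarrow> fraction (A $ 1 $ 1 * z + A $ 1 $ 2) (A $ 2 $ 1 * z + A $ 2 $ 2))"

definition path_pairs :: "((int \<Rightarrow> complex option) \<times> (int \<Rightarrow> complex option)) set" where
  "path_pairs = {(u, v). bi_infinite_path u \<and> bi_infinite_path v}"

definition path_pair_rel ::
  "((int \<Rightarrow> complex option) \<times> (int \<Rightarrow> complex option)) rel" where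
  "path_pair_rel = {((u, v), (u', v')).
     (u, v) \<in> path_pairs \<and> (u', v') \<in> path_pairs \<and>
     (\<exists>A\<in>SL2_eisenstein. (\<forall>i. u' i = mobius A (u i)) \<and> (\<forall>j. v' j = mobius A (v j)))}"

definition SL2_tiling :: "(int \<Rightarrow> int \<Rightarrow> complex) \<Rightarrow> bool" where
  "SL2_tiling m \<longleftrightarrow> (\<forall>i j. m i j \<in> eisenstein_ints) \<and>
     (\<forall>i j. m i j * m (i + 1) (j + 1) - m i (j + 1) * m (i + 1) j = 1)"

definition tame :: "(int \<Rightarrow> int \<Rightarrow> complex) \<Rightarrow> bool" where
  "tame m \<longleftrightarrow> (\<forall>i j. det (vector
      [vector [m i j,       m i (j + 1),       m i (j + 2)],
       vector [m (i + 1) j, m (i + 1) (j + 1), m (i + 1) (j + 2)],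
       vector [m (i + 2) j, m (i + 2) (j + 1), m (i + 2) (j + 2)]] :: complex^3^3) = 0)"

definition tame_SL2_tilings :: "(int \<Rightarrow> int \<Rightarrow> complex) set" where
  "tame_SL2_tilings = {m. SL2_tiling m \<and> tame m}"

text \<open>The sign \<open>(-1)^i\<close> for an integer \<open>i\<close>, possibly negative.\<close>

definition alt_sign :: "int \<Rightarrow> int" where
  "alt_sign i = (if even i then 1 else -1)"

definition tiling_rel :: "(int \<Rightarrow> int \<Rightarrow> complex) rel" where
  "tiling_rel = {(m, m'). m \<in> tame_SL2_tilings \<and> m' \<in> tame_SL2_tilings \<and>
     (\<exists>k l :: int. \<forall>i j. m' i j = \<sigma> powi (alt_sign i * k + alt_sign j * l) * m i j)}"

definition path_matrix :: "(int \<Rightarrow> complex) \<Rightarrow> (int \<Rightarrow> complex) \<Rightarrow>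
    (int \<Rightarrow> complex) \<Rightarrow> (int \<Rightarrow> complex) \<Rightarrow> int \<Rightarrow> int \<Rightarrow> complex" where
  "path_matrix p q r s i j = p i * s j - q i * r j"

text \<open>The two relations are equivalence relations, so their quotients \<open>//\<close> are partitions.\<close>

lemma \<sigma>_nonzero: "\<sigma> \<noteq> 0"
  by (simp add: \<sigma>_def)

lemma equiv_tiling_rel: "equiv tame_SL2_tilings tiling_rel"
proof (rule equivI)
  show "tiling_rel \<subseteq> tame_SL2_tilings \<times> tame_SL2_tilings"
    by (auto simp: tiling_rel_def)
  show "refl_on tame_SL2_tilings tiling_rel"
    unfolding refl_on_def tiling_rel_def by (auto intro!: exI[of _ 0])
  show "sym tiling_rel"
  proof (rule symI)
    fix m m' assume h: "(m, m') \<in> tiling_rel"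
    then obtain k l where
      kl: "\<And>i j. m' i j = \<sigma> powi (alt_sign i * k + alt_sign j * l) * m i j"
      by (auto simp: tiling_rel_def)
    have "m i j = \<sigma> powi (alt_sign i * (-k) + alt_sign j * (-l)) * m' i j" for i j
    proof -
      have "\<sigma> powi (alt_sign i * (-k) + alt_sign j * (-l)) *
            \<sigma> powi (alt_sign i * k + alt_sign j * l) = 1"
        by (simp add: power_int_add[symmetric] \<sigma>_nonzero)
      then show ?thesis
        by (simp add: kl mult.assoc[symmetric])
    qed
    with h show "(m', m) \<in> tiling_rel"
      unfolding tiling_rel_def by blast
  qed
  show "trans tiling_rel"
  proof (rule transI)
    fix m m' m'' assume h: "(m, m') \<in> tiling_rel" "(m', m'') \<in> tiling_rel"
    obtain k l where kl: "\<And>i j. m' i j = \<sigma> powi (alt_sign i * k + alt_sign j * l) * m i j"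
      using h(1) by (auto simp: tiling_rel_def)
    obtain k' l' where
      kl': "\<And>i j. m'' i j = \<sigma> powi (alt_sign i * k' + alt_sign j * l') * m' i j"
      using h(2) by (auto simp: tiling_rel_def)
    have "m'' i j = \<sigma> powi (alt_sign i * (k' + k) + alt_sign j * (l' + l)) * m i j" for i j
    proof -
      have e: "alt_sign i * (k' + k) + alt_sign j * (l' + l) =
            (alt_sign i * k' + alt_sign j * l') + (alt_sign i * k + alt_sign j * l)"
        by (simp add: algebra_simps)
      show ?thesis
        unfolding e kl kl' by (subst power_int_add) (auto simp: \<sigma>_nonzero)
    qed
    with h show "(m, m'') \<in> tiling_rel"
      unfolding tiling_rel_def by blast
  qed
qed

lemma mobius_fraction:
  assumes "\<not> (p = 0 \<and> q = 0)"
  shows "mobius A (fraction p q) =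
    fraction (A $ 1 $ 1 * p + A $ 1 $ 2 * q) (A $ 2 $ 1 * p + A $ 2 $ 2 * q)"
proof (cases "q = 0")
  case True
  with assms show ?thesis by (simp add: mobius_def fraction_def)
next
  case False
  have "A $ i $ 1 * (p / q) + A $ i $ 2 = (A $ i $ 1 * p + A $ i $ 2 * q) / q" for i
    using False by (simp add: field_simps)
  with False show ?thesis by (simp add: mobius_def fraction_def)
qed

lemma mobius_mobius:
  assumes "det B = 1"
  shows "mobius A (mobius B x) = mobius (A ** B) x"
proof -
  obtain p q where x: "x = fraction p q" and pq: "\<not> (p = 0 \<and> q = 0)"
  proof (cases x)
    case None
    then show thesis using that[of 1 0] by (simp add: fraction_def)
  next
    case (Some z)
    then show thesis using that[of z 1] by (simp add: fraction_def)
  qed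
  let ?P = "B $ 1 $ 1 * p + B $ 1 $ 2 * q" and ?Q = "B $ 2 $ 1 * p + B $ 2 $ 2 * q"
  have d: "B $ 1 $ 1 * B $ 2 $ 2 - B $ 1 $ 2 * B $ 2 $ 1 = 1"
    using assms by (simp add: det_2)
  have "p = (B $ 1 $ 1 * B $ 2 $ 2 - B $ 1 $ 2 * B $ 2 $ 1) * p"
    "q = (B $ 1 $ 1 * B $ 2 $ 2 - B $ 1 $ 2 * B $ 2 $ 1) * q"
    by (simp_all add: d)
  then have "p = B $ 2 $ 2 * ?P - B $ 1 $ 2 * ?Q" "q = B $ 1 $ 1 * ?Q - B $ 2 $ 1 * ?P"
    by (simp_all add: algebra_simps)
  with pq have PQ: "\<not> (?P = 0 \<and> ?Q = 0)"
    by auto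
  show ?thesis
    unfolding x mobius_fraction[OF pq] mobius_fraction[OF PQ]
    by (simp add: matrix_matrix_mult_def sum_2 algebra_simps)
qed

lemma \<sigma>_squared: "\<sigma> * \<sigma> = \<sigma> - 1"
proof -
  have s: "\<sigma> = Complex (1 / 2) (sqrt 3 / 2)"
    by (simp add: \<sigma>_def complex_eq_iff Re_exp Im_exp cos_60 sin_60)
  show ?thesis
    by (simp add: s complex_eq_iff)
qed

lemma eisenstein_intsI: "x = of_int a + of_int b * \<sigma> \<Longrightarrow> x \<in> eisenstein_ints"
  by (auto simp: eisenstein_ints_def)

lemma eisenstein_ints_0: "0 \<in> eisenstein_ints"
  by (rule eisenstein_intsI[of _ 0 0]) simp

lemma eisenstein_ints_1: "1 \<in> eisenstein_ints"
  by (rule eisenstein_intsI[of _ 1 0]) simp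

lemma eisenstein_ints_add:
  assumes "x \<in> eisenstein_ints" "y \<in> eisenstein_ints"
  shows "x + y \<in> eisenstein_ints"
proof -
  obtain a b c d where "x = of_int a + of_int b * \<sigma>" "y = of_int c + of_int d * \<sigma>"
    using assms by (auto simp: eisenstein_ints_def)
  then show ?thesis
    by (intro eisenstein_intsI[of _ "a + c" "b + d"]) (simp add: algebra_simps)
qed

lemma eisenstein_ints_minus:
  assumes "x \<in> eisenstein_ints"
  shows "- x \<in> eisenstein_ints"
proof -
  obtain a b where "x = of_int a + of_int b * \<sigma>"
    using assms by (auto simp: eisenstein_ints_def)
  then show ?thesis
    by (intro eisenstein_intsI[of _ "- a" "- b"]) (simp add: algebra_simps)
qed

lemma eisenstein_ints_mult:
  assumes "x \<in> eisenstein_ints" "y \<in> eisenstein_ints"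
  shows "x * y \<in> eisenstein_ints"
proof -
  obtain a b c d where
    xy: "x = of_int a + of_int b * \<sigma>" "y = of_int c + of_int d * \<sigma>"
    using assms by (auto simp: eisenstein_ints_def)
  have "x * y = of_int a * of_int c + (of_int a * of_int d + of_int b * of_int c) * \<sigma> +
      of_int b * of_int d * (\<sigma> * \<sigma>)"
    unfolding xy by (simp add: algebra_simps)
  also have "\<dots> = of_int (a * c - b * d) + of_int (a * d + b * c + b * d) * \<sigma>"
    unfolding \<sigma>_squared by (simp add: algebra_simps)
  finally show ?thesis
    by (rule eisenstein_intsI)
qed

lemma SL2_eisenstein_one: "mat 1 \<in> SL2_eisenstein"
  unfolding SL2_eisenstein_def
  by (auto simp: mat_def eisenstein_ints_0 eisenstein_ints_1 det_2)

lemma SL2_eisenstein_mult: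
  assumes "A \<in> SL2_eisenstein" "B \<in> SL2_eisenstein"
  shows "A ** B \<in> SL2_eisenstein"
proof -
  have "det (A ** B) = 1"
    using assms by (simp add: SL2_eisenstein_def det_mul)
  moreover have "(A ** B) $ i $ j \<in> eisenstein_ints" for i j
    using assms by (auto simp: SL2_eisenstein_def matrix_matrix_mult_def sum_2
        intro!: eisenstein_ints_add eisenstein_ints_mult)
  ultimately show ?thesis
    by (simp add: SL2_eisenstein_def)
qed

lemma SL2_eisenstein_inverse:
  assumes "A \<in> SL2_eisenstein"
  obtains B where "B \<in> SL2_eisenstein" "B ** A = mat 1"
proof
  let ?B = "vector [vector [A $ 2 $ 2, - A $ 1 $ 2],
                    vector [- A $ 2 $ 1, A $ 1 $ 1]] :: complex^2^2"
  have d: "A $ 1 $ 1 * A $ 2 $ 2 - A $ 1 $ 2 * A $ 2 $ 1 = 1"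
    using assms by (simp add: SL2_eisenstein_def det_2)
  show "?B \<in> SL2_eisenstein"
    using assms d
    by (auto simp: SL2_eisenstein_def forall_2 det_2 algebra_simps intro: eisenstein_ints_minus)
  show "?B ** A = mat 1"
    using d by (simp add: vec_eq_iff forall_2 matrix_matrix_mult_def sum_2 mat_def algebra_simps)
qed

lemma mobius_one: "mobius (mat 1) x = x"
  by (cases x) (simp_all add: mobius_def fraction_def mat_def)

lemma equiv_path_pair_rel: "equiv path_pairs path_pair_rel"
proof (rule equivI)
  show "path_pair_rel \<subseteq> path_pairs \<times> path_pairs"
    by (auto simp: path_pair_rel_def)
  show "refl_on path_pairs path_pair_rel"
    unfolding refl_on_def path_pair_rel_def
    by (auto intro!: bexI[OF _ SL2_eisenstein_one] simp: mobius_one)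
  show "sym path_pair_rel"
  proof (rule symI, clarify)
    fix u v u' v' assume h: "((u, v), (u', v')) \<in> path_pair_rel"
    then obtain A where A: "A \<in> SL2_eisenstein" "\<And>i. u' i = mobius A (u i)"
      "\<And>j. v' j = mobius A (v j)"
      by (auto simp: path_pair_rel_def)
    obtain B where B: "B \<in> SL2_eisenstein" "B ** A = mat 1"
      using SL2_eisenstein_inverse[OF A(1)] .
    have "mobius B (mobius A x) = x" for x
      using A(1) B(2) by (simp add: mobius_mobius mobius_one SL2_eisenstein_def)
    with h A B(1) show "((u', v'), (u, v)) \<in> path_pair_rel"
      unfolding path_pair_rel_def by (auto intro!: bexI[of _ B])
  qed
  show "trans path_pair_rel"
  proof (rule transI, clarify)
    fix u v u' v' u'' v''
    assume h: "((u, v), (u', v')) \<in> path_pair_rel" "((u', v'), (u'', v'')) \<in> path_pair_rel"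
    obtain A where A: "A \<in> SL2_eisenstein" "\<And>i. u' i = mobius A (u i)"
      "\<And>j. v' j = mobius A (v j)"
      using h(1) by (auto simp: path_pair_rel_def)
    obtain B where B: "B \<in> SL2_eisenstein" "\<And>i. u'' i = mobius B (u' i)"
      "\<And>j. v'' j = mobius B (v' j)"
      using h(2) by (auto simp: path_pair_rel_def)
    have "mobius B (mobius A x) = mobius (B ** A) x" for x
      using A(1) by (simp add: mobius_mobius SL2_eisenstein_def)
    then have "\<And>i. u'' i = mobius (B ** A) (u i)" "\<And>j. v'' j = mobius (B ** A) (v j)"
      by (simp_all add: A(2,3) B(2,3))
    with h SL2_eisenstein_mult[OF B(1) A(1)] show "((u, v), (u'', v'')) \<in> path_pair_rel"
      unfolding path_pair_rel_def by blast
  qed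
qed

end

theory Submission
  imports Defs
begin

text \<open>Adjacency in \<open>\<T>\<close> provides Bezout coefficients for the endpoints of an edge, so an
  irreducible fraction on a path is determined up to a unit, that is, up to a power of \<open>\<sigma>\<close>; no
  Euclidean algorithm is needed. A path normalisation is then a sequence of vectors with
  consecutive determinants 1, and \<open>m\<^sub>i\<^sub>j\<close> is the determinant of the \<open>i\<close>-th vector of one
  sequence and the \<open>j\<close>-th vector of the other. These determinants are \<open>SL\<^sub>2\<close>-invariant, and they
  determine both sequences up to \<open>SL\<^sub>2\<close> because two consecutive vectors form a basis. Conversely,
  the vanishing \<open>3\<times>3\<close> determinants of a tame tiling allow one to recover it from rows 0, 1 and
  columns 0, 1, from which the two paths can be read off.\<close>

section \<open>Eisenstein integers\<close>

lemma \<sigma>_Complex: "\<sigma> = Complex (1 / 2) (sqrt 3 / 2)"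
  by (simp add: \<sigma>_def complex_eq_iff Re_exp Im_exp cos_60 sin_60)

lemma cnj_\<sigma>: "cnj \<sigma> = 1 - \<sigma>"
  by (simp add: \<sigma>_Complex complex_eq_iff)

lemma cmod_\<sigma>: "cmod \<sigma> = 1"
  by (simp add: \<sigma>_def)

lemma eisenstein_ints_diff:
  "x \<in> eisenstein_ints \<Longrightarrow> y \<in> eisenstein_ints \<Longrightarrow> x - y \<in> eisenstein_ints"
  using eisenstein_ints_add[OF _ eisenstein_ints_minus, of x y] by simp

lemmas eisenstein_ints_closed = eisenstein_ints_0 eisenstein_ints_1 eisenstein_ints_add
  eisenstein_ints_minus eisenstein_ints_diff eisenstein_ints_mult

lemma eisenstein_ints_cnj:
  assumes "x \<in> eisenstein_ints"
  shows "cnj x \<in> eisenstein_ints"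
proof -
  obtain a b where "x = of_int a + of_int b * \<sigma>"
    using assms by (auto simp: eisenstein_ints_def)
  then show ?thesis
    by (intro eisenstein_intsI[of _ "a + b" "- b"]) (simp add: cnj_\<sigma> algebra_simps)
qed

text \<open>The squared modulus is an integral quadratic form. Its integrality bounds nonzero
  elements away from 0 and turns the search for units into a Diophantine equation.\<close>

lemma norm_eisenstein:
  "(cmod (of_int a + of_int b * \<sigma>))\<^sup>2 = of_int (a * a + a * b + b * b)"
proof -
  have "(cmod (of_int a + of_int b * \<sigma>))\<^sup>2
      = (of_int a + of_int b / 2)\<^sup>2 + (of_int b * sqrt 3 / 2)\<^sup>2"
    unfolding cmod_power2 by (simp add: \<sigma>_Complex)
  also have "\<dots> = of_int (a * a + a * b + b * b)"
    by (simp add: power2_eq_square field_simps)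
  finally show ?thesis .
qed

lemma eisenstein_norm_ge_1:
  assumes "x \<in> eisenstein_ints" "x \<noteq> 0"
  shows "cmod x \<ge> 1"
proof -
  obtain a b where x: "x = of_int a + of_int b * \<sigma>"
    using assms by (auto simp: eisenstein_ints_def)
  have "(cmod x)\<^sup>2 > 0"
    using assms by simp
  then have "0 < a * a + a * b + b * b"
    unfolding x norm_eisenstein of_int_0_less_iff .
  then have "1 \<le> a * a + a * b + b * b"
    by simp
  then have "(cmod x)\<^sup>2 \<ge> 1\<^sup>2"
    unfolding x norm_eisenstein power_one of_int_1_le_iff .
  then show ?thesis
    by (rule power2_le_imp_le) simp
qed

text \<open>The norm equation a^2 + ab + b^2 = 1 has six integer solutions, and they are the powers
  of \<sigma> with exponents 0 to 5.\<close>

lemma eisenstein_unit_powi: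
  assumes "x \<in> eisenstein_ints" "cmod x = 1"
  obtains k :: int where "x = \<sigma> powi k"
proof -
  obtain a b where x: "x = of_int a + of_int b * \<sigma>"
    using assms by (auto simp: eisenstein_ints_def)
  have "of_int (a * a + a * b + b * b) = (of_int 1 :: real)"
    using norm_eisenstein[of a b] assms(2) unfolding x by simp
  then have n: "a * a + a * b + b * b = 1"
    unfolding of_int_eq_iff .
  \<comment> \<open>Since 4(c^2 + cd + d^2) = 3c^2 + (c + 2d)^2, a value c^2 >= 4 would push the
    form above 1. The form is symmetric, so this bounds both coefficients.\<close>
  have small: "\<bar>c\<bar> \<le> 1" if "c * c + c * d + d * d = 1" for c d :: int
  proof (rule ccontr)
    assume "\<not> \<bar>c\<bar> \<le> 1"
    then have "2\<^sup>2 \<le> \<bar>c\<bar>\<^sup>2"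
      by (intro power_mono) auto
    then have "4 \<le> c * c"
      by (simp add: power2_eq_square)
    moreover have "0 \<le> (c + 2 * d) * (c + 2 * d)"
      by simp
    ultimately show False
      using that by (simp add: algebra_simps)
  qed
  have "\<bar>a\<bar> \<le> 1" "\<bar>b\<bar> \<le> 1"
    using small[of a b] small[of b a] n by (auto simp: algebra_simps)
  then have "a \<in> {-1, 0, 1}" "b \<in> {-1, 0, 1}"
    by auto
  then have cases: "x \<in> {1, -1, \<sigma>, -\<sigma>, \<sigma> - 1, 1 - \<sigma>}"
    using n unfolding x by auto
  have s2: "\<sigma> powi 2 = \<sigma> - 1"
    by (simp add: power2_eq_square \<sigma>_squared)
  have s3: "\<sigma> powi 3 = -1"
    by (simp add: power3_eq_cube \<sigma>_squared algebra_simps)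
  have s4: "\<sigma> powi 4 = - \<sigma>"
    using power_int_add[of \<sigma> 3 1] unfolding s3 by (simp add: \<sigma>_nonzero)
  have s5: "\<sigma> powi 5 = 1 - \<sigma>"
    using power_int_add[of \<sigma> 3 2] unfolding s3 s2 by (simp add: \<sigma>_nonzero)
  show thesis
    using cases that[of 0] that[of 1] that[of 2] that[of 3] that[of 4] that[of 5] s2 s3 s4 s5
    by auto
qed

section \<open>Unimodular pairs\<close>

text \<open>Coprimality is encoded by Bezout coefficients, because these can be computed with
  directly: they pass from an edge to its endpoints and yield the unit relating two representations
  of a vertex.\<close>

definition unimodular :: "complex \<Rightarrow> complex \<Rightarrow> bool" where
  "unimodular p q \<longleftrightarrow> p \<in> eisenstein_ints \<and> q \<in> eisenstein_ints \<and>
     (\<exists>a\<in>eisenstein_ints. \<exists>b\<in>eisenstein_ints. a * p + b * q = 1)"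

lemma unimodular_nonzero: "unimodular p q \<Longrightarrow> \<not> (p = 0 \<and> q = 0)"
  by (auto simp: unimodular_def)

lemma eisenstein_factor_of_1:
  assumes "x \<in> eisenstein_ints" "y \<in> eisenstein_ints" "x * y = 1"
  shows "cmod x = 1"
proof -
  have "x \<noteq> 0" "y \<noteq> 0"
    using assms(3) by auto
  then have "cmod x \<ge> 1" "cmod y \<ge> 1"
    using assms by (auto intro: eisenstein_norm_ge_1)
  moreover have "cmod x * cmod y = 1"
    by (metis assms(3) norm_mult norm_one)
  ultimately show ?thesis
    using mult_left_mono[of 1 "cmod y" "cmod x"] by simp
qed

lemma unimodular_irreducible:
  assumes "unimodular p q"
  shows "irreducible_fraction p q"
proof -
  obtain a b where ab: "a \<in> eisenstein_ints" "b \<in> eisenstein_ints" "a * p + b * q = 1"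
    using assms by (auto simp: unimodular_def)
  have "cmod k = 1" if k: "common_factor k p q" for k
  proof -
    obtain c d where cd: "c \<in> eisenstein_ints" "d \<in> eisenstein_ints" "p = k * c" "q = k * d"
      using k by (auto simp: common_factor_def)
    have "k * (a * c + b * d) = 1"
      using ab(3) cd by (simp add: algebra_simps)
    moreover have "k \<in> eisenstein_ints"
      using k by (simp add: common_factor_def)
    ultimately show ?thesis
      using ab cd eisenstein_factor_of_1[of k "a * c + b * d"] by (simp add: eisenstein_ints_closed)
  qed
  then show ?thesis
    using assms unimodular_nonzero[OF assms] by (auto simp: irreducible_fraction_def unimodular_def)
qed

text \<open>A determinant of modulus 1 has its conjugate \<open>e\<close> as inverse, so multiplying
  the determinant by \<open>e\<close> and expanding gives a Bezout identity for either
  column.\<close>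

lemma unimodular_of_unit_det:
  assumes E: "p \<in> eisenstein_ints" "q \<in> eisenstein_ints" "r \<in> eisenstein_ints" "s \<in> eisenstein_ints"
    and d: "cmod (p * s - r * q) = 1"
  shows "unimodular p q" "unimodular r s"
proof -
  define e where "e = cnj (p * s - r * q)"
  have e: "e \<in> eisenstein_ints"
    unfolding e_def using E by (intro eisenstein_ints_cnj eisenstein_ints_closed)
  have "(p * s - r * q) * e = 1"
    unfolding e_def complex_norm_square[symmetric] d by simp
  then have "(e * s) * p + (- (e * r)) * q = 1" "(- (e * q)) * r + (e * p) * s = 1"
    by (simp_all add: algebra_simps)
  then show "unimodular p q" "unimodular r s"
    unfolding unimodular_def using E e by (blast intro: eisenstein_ints_closed)+
qed

lemma fraction_eq_imp_cross:
  assumes "fraction p q = fraction r s" "\<not> (p = 0 \<and> q = 0)" "\<not> (r = 0 \<and> s = 0)"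
  shows "p * s = r * q"
  using assms by (auto simp: fraction_def field_simps split: if_splits)

lemma fraction_scale: "e \<noteq> 0 \<Longrightarrow> fraction (e * p) (e * q) = fraction p q"
  by (simp add: fraction_def)

text \<open>Applying the Bezout coefficients of one pair to the other pair gives the scaling factor
  \<open>e\<close>; exchanging the roles gives its inverse \<open>f\<close>, so \<open>e\<close> is
  a unit.\<close>

lemma unimodular_fraction_unique:
  assumes u: "unimodular p q" "unimodular p' q'" and eq: "fraction p q = fraction p' q'"
  obtains e where "e \<in> eisenstein_ints" "cmod e = 1" "p' = e * p" "q' = e * q"
proof -
  have x: "p * q' = p' * q"
    using fraction_eq_imp_cross[OF eq] u by (auto dest: unimodular_nonzero)
  obtain a b where ab: "a \<in> eisenstein_ints" "b \<in> eisenstein_ints" "a * p + b * q = 1"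
    using u by (auto simp: unimodular_def)
  obtain c d where cd: "c \<in> eisenstein_ints" "d \<in> eisenstein_ints" "c * p' + d * q' = 1"
    using u by (auto simp: unimodular_def)
  define e where "e = a * p' + b * q'"
  define f where "f = c * p + d * q"
  have "e * p = p' * (a * p + b * q)" "e * q = q' * (a * p + b * q)"
    using x unfolding e_def by algebra+
  then have ep: "p' = e * p" "q' = e * q"
    by (simp_all add: ab)
  have "e * f = c * p' + d * q'"
    unfolding ep f_def by (simp add: algebra_simps)
  then have "e * f = 1"
    by (simp add: cd)
  moreover have E: "e \<in> eisenstein_ints" "f \<in> eisenstein_ints"
    using ab cd u by (auto simp: e_def f_def unimodular_def intro!: eisenstein_ints_closed)
  ultimately show thesis
    using that ep eisenstein_factor_of_1 by blast
qed

text \<open>Multiplying through by the conjugate of the denominator makes the denominator an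
  ordinary integer.\<close>

lemma fraction_in_extended:
  assumes "p \<in> eisenstein_ints" "q \<in> eisenstein_ints"
  shows "fraction p q \<in> extended_eisenstein_rats"
proof (cases "q = 0")
  case True
  then show ?thesis
    by (simp add: fraction_def extended_eisenstein_rats_def)
next
  case False
  obtain a b where q: "q = of_int a + of_int b * \<sigma>"
    using assms by (auto simp: eisenstein_ints_def)
  have "p * cnj q \<in> eisenstein_ints"
    using assms by (intro eisenstein_ints_closed eisenstein_ints_cnj)
  then obtain c d where pq: "p * cnj q = of_int c + of_int d * \<sigma>"
    by (auto simp: eisenstein_ints_def)
  define n where "n = a * a + a * b + b * b"
  have n: "q * cnj q = of_int n"
    unfolding complex_norm_square[symmetric] q norm_eisenstein n_def by simp
  have "p / q = (p * cnj q) / (q * cnj q)"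
    using False by simp
  also have "\<dots> = of_rat (of_int c / of_int n) + of_rat (of_int d / of_int n) * \<sigma>"
    unfolding n pq by (simp add: of_rat_divide add_divide_distrib)
  finally have "p / q \<in> eisenstein_rats"
    unfolding eisenstein_rats_def by blast
  then show ?thesis
    using False by (simp add: fraction_def extended_eisenstein_rats_def)
qed

section \<open>Normalisations\<close>

lemma adjacentE:
  assumes "adjacent x y"
  obtains p q r s where "unimodular p q" "unimodular r s" "x = fraction p q" "y = fraction r s"
    "cmod (p * s - r * q) = 1"
  using assms unimodular_of_unit_det unfolding adjacent_def irreducible_fraction_def by metis

text \<open>Adjacency only provides some pair of representatives with unit determinant. Other
  unimodular representatives differ by units, which do not change the modulus of the
  determinant.\<close>

lemma adjacent_unit_det:
  assumes "adjacent (fraction p q) (fraction r s)" "unimodular p q" "unimodular r s"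
  shows "cmod (p * s - r * q) = 1"
proof -
  obtain p' q' r' s' where u: "unimodular p' q'" "unimodular r' s'"
      "fraction p' q' = fraction p q" "fraction r' s' = fraction r s"
    and d: "cmod (p' * s' - r' * q') = 1"
    using adjacentE[OF assms(1)] by metis
  obtain e where e: "cmod e = 1" "p = e * p'" "q = e * q'"
    using unimodular_fraction_unique[OF u(1) assms(2) u(3)] by metis
  obtain f where f: "cmod f = 1" "r = f * r'" "s = f * s'"
    using unimodular_fraction_unique[OF u(2) assms(3) u(4)] by metis
  have "p * s - r * q = e * f * (p' * s' - r' * q')"
    unfolding e f by (simp add: algebra_simps)
  then show ?thesis
    by (simp add: norm_mult e(1) f(1) d)
qed

definition unimodular_seq :: "(int \<Rightarrow> complex) \<Rightarrow> (int \<Rightarrow> complex) \<Rightarrow> bool" where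
  "unimodular_seq p q \<longleftrightarrow> (\<forall>i. p i \<in> eisenstein_ints \<and> q i \<in> eisenstein_ints) \<and>
     (\<forall>i. p i * q (i + 1) - p (i + 1) * q i = 1)"

lemma unimodular_seqD:
  assumes "unimodular_seq p q"
  shows "p i \<in> eisenstein_ints" "q i \<in> eisenstein_ints"
    "p i * q (i + 1) - p (i + 1) * q i = 1" "unimodular (p i) (q i)"
proof -
  show *: "p i \<in> eisenstein_ints" "q i \<in> eisenstein_ints"
    "p i * q (i + 1) - p (i + 1) * q i = 1" for i
    using assms by (auto simp: unimodular_seq_def)
  show "unimodular (p i) (q i)"
    by (rule unimodular_of_unit_det(1)[OF *(1)[of i] *(2)[of i] *(1)[of "i + 1"] *(2)[of "i + 1"]])
      (simp add: *(3))
qed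

text \<open>Consecutive determinants 1 make every pair unimodular and hence irreducible.
  Normalisations can therefore be handled as sequences of vectors, without reference to a
  path.\<close>

lemma normalisation_iff:
  "normalisation v p q \<longleftrightarrow> unimodular_seq p q \<and> (\<forall>i. v i = fraction (p i) (q i))"
  using unimodular_irreducible[OF unimodular_seqD(4)]
  by (auto simp: normalisation_def unimodular_seq_def irreducible_fraction_def)

lemma bi_infinite_path_of_unimodular_seq:
  assumes "unimodular_seq p q"
  shows "bi_infinite_path (\<lambda>i. fraction (p i) (q i))"
  unfolding bi_infinite_path_def
proof (intro conjI allI)
  show *: "fraction (p i) (q i) \<in> extended_eisenstein_rats" for i
    by (intro fraction_in_extended unimodular_seqD[OF assms])
  show "adjacent (fraction (p i) (q i)) (fraction (p (i + 1)) (q (i + 1)))" for i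
    unfolding adjacent_def
    using * unimodular_irreducible[OF unimodular_seqD(4)[OF assms]] unimodular_seqD(3)[OF assms, of i]
    by (metis norm_one)
qed

text \<open>Two-sided recursion: on \<open>P\<close>, each step \<open>g i\<close> is undone by
  \<open>h i\<close>, so a forward and a backward orbit of \<open>x\<close> glue together to a
  sequence over all integers.\<close>

lemma int_recursion:
  fixes g h :: "int \<Rightarrow> 'a \<Rightarrow> 'a"
  assumes P0: "P x" and Pg: "\<And>i y. P y \<Longrightarrow> P (g i y)" and Ph: "\<And>i y. P y \<Longrightarrow> P (h i y)"
    and gh: "\<And>i y. P y \<Longrightarrow> g i (h i y) = y"
  obtains f where "\<And>i. P (f i)" "\<And>i. f (i + 1) = g i (f i)"
proof -
  define F where "F = rec_nat x (\<lambda>n. g (int n))"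
  \<comment> \<open>\<open>B n\<close> is the value at index -n, so the passage to
    \<open>B (Suc n)\<close> has to undo the step that leaves index -n - 1.\<close>
  define B where "B = rec_nat x (\<lambda>n. h (- int n - 1))"
  define f where "f i = (if i \<ge> 0 then F (nat i) else B (nat (- i)))" for i
  have PF: "P (F n)" for n
    by (induction n) (auto simp: F_def P0 Pg)
  have PB: "P (B n)" for n
    by (induction n) (auto simp: B_def P0 Ph)
  have "P (f i)" for i
    by (simp add: f_def PF PB)
  moreover have "f (i + 1) = g i (f i)" for i
  proof (cases "i \<ge> 0")
    case True
    then show ?thesis
      by (simp add: f_def F_def nat_add_distrib)
  next
    case False
    define n where "n = nat (- i - 1)"
    have n: "i = - int n - 1"
      using False by (simp add: n_def)
    \<comment> \<open>For n = 0 the index \<open>i + 1\<close> is 0, where the halves meet: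
      \<open>F 0\<close> and \<open>B 0\<close> are both \<open>x\<close>.\<close>
    have "f (i + 1) = B n"
      by (cases n) (auto simp: f_def n F_def B_def nat_add_distrib)
    moreover have "f i = h i (B n)"
    proof -
      have "nat (- i) = Suc n"
        using n by simp
      then show ?thesis
        using False by (simp add: f_def B_def n)
    qed
    ultimately show ?thesis
      by (simp add: gh PB)
  qed
  ultimately show thesis
    using that by blast
qed

text \<open>Arbitrary unimodular representatives have unit determinants \<open>D i\<close>.
  Rescaling by units \<open>e i\<close> turns these into 1 if
  \<open>D i * e i * e (i + 1) = 1\<close>; as the inverse of a unit is its conjugate, this is a
  recursion for \<open>e\<close>.\<close>

lemma bi_infinite_path_normalisation:
  assumes "bi_infinite_path w"
  obtains p q where "normalisation w p q"
proof -
  have "\<exists>p q. unimodular p q \<and> w i = fraction p q" for i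
    using assms adjacentE unfolding bi_infinite_path_def by metis
  then obtain P Q where PQ: "\<And>i. unimodular (P i) (Q i)" "\<And>i. w i = fraction (P i) (Q i)"
    by metis
  define D where "D i = P i * Q (i + 1) - P (i + 1) * Q i" for i
  have D: "cmod (D i) = 1" for i
    unfolding D_def using assms PQ
    by (intro adjacent_unit_det) (auto simp: bi_infinite_path_def)
  have DE: "D i \<in> eisenstein_ints" for i
    unfolding D_def using PQ(1) by (intro eisenstein_ints_closed) (auto simp: unimodular_def)
  define unit where "unit e \<longleftrightarrow> e \<in> eisenstein_ints \<and> cmod e = 1" for e
  have cnj_unit: "e * cnj e = 1" if "unit e" for e
    using that unfolding unit_def complex_norm_square[symmetric] by simp
  have uD: "unit (D i)" for i
    by (simp add: unit_def D DE)
  have step: "unit (cnj (D i * e))" if "unit e" for i e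
    using that uD[of i] unfolding unit_def complex_mod_cnj norm_mult
    by (auto intro!: eisenstein_ints_cnj eisenstein_ints_mult simp del: complex_cnj_mult)
  \<comment> \<open>On units the recursion step is an involution, so the same map serves forwards
    and backwards.\<close>
  have inv: "cnj (D i * cnj (D i * e)) = e" if "unit e" for i e
    using cnj_unit[OF uD[of i]] by (simp add: algebra_simps)
  obtain e where e: "\<And>i. unit (e i)" "\<And>i. e (i + 1) = cnj (D i * e i)"
    using int_recursion[of unit 1 "\<lambda>i e. cnj (D i * e)" "\<lambda>i e. cnj (D i * e)"] step inv
    by (metis unit_def eisenstein_ints_1 norm_one)
  have "normalisation w (\<lambda>i. e i * P i) (\<lambda>i. e i * Q i)"
    unfolding normalisation_iff unimodular_seq_def
  proof (intro conjI allI)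
    fix i
    show "e i * P i \<in> eisenstein_ints" "e i * Q i \<in> eisenstein_ints"
      using e(1)[of i] PQ(1)[of i] by (auto simp: unit_def unimodular_def intro: eisenstein_ints_mult)
    show "w i = fraction (e i * P i) (e i * Q i)"
      using e(1)[of i] PQ(2)[of i] by (subst fraction_scale) (auto simp: unit_def)
    have "e i * P i * (e (i + 1) * Q (i + 1)) - e (i + 1) * P (i + 1) * (e i * Q i)
        = (D i * e i) * e (i + 1)"
      by (simp add: D_def algebra_simps)
    also have "\<dots> = (D i * cnj (D i)) * (e i * cnj (e i))"
      by (simp add: e(2))
    also have "\<dots> = 1"
      by (simp add: cnj_unit[OF uD] cnj_unit[OF e(1)])
    finally show "e i * P i * (e (i + 1) * Q (i + 1)) - e (i + 1) * P (i + 1) * (e i * Q i) = 1" .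
  qed
  then show thesis
    using that by blast
qed

lemma int_shift_induct:
  fixes P :: "int \<Rightarrow> bool"
  assumes "P 0" "\<And>i. P i \<longleftrightarrow> P (i + 1)"
  shows "P i"
proof (induction i rule: int_induct[where k = 0])
  case (step2 i)
  then show ?case
    using assms(2)[of "i - 1"] by simp
qed (use assms in auto)

text \<open>The units \<open>e i\<close> relating the two sequences satisfy
  \<open>e i * e (i + 1) = 1\<close>, because both have consecutive determinants 1. Hence
  \<open>e 0\<close> fixes all of them, with alternating exponents.\<close>

lemma unimodular_seq_unique:
  assumes u: "unimodular_seq p q" "unimodular_seq p' q'"
    and eq: "\<And>i. fraction (p i) (q i) = fraction (p' i) (q' i)"
  obtains k :: int where "\<And>i. p' i = \<sigma> powi (alt_sign i * k) * p i"
    "\<And>i. q' i = \<sigma> powi (alt_sign i * k) * q i"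
proof -
  have "\<exists>e. e \<in> eisenstein_ints \<and> cmod e = 1 \<and> p' i = e * p i \<and> q' i = e * q i" for i
    using unimodular_fraction_unique[OF unimodular_seqD(4)[OF u(1)] unimodular_seqD(4)[OF u(2)] eq]
    by metis
  then obtain e where e: "\<And>i. e i \<in> eisenstein_ints" "\<And>i. cmod (e i) = 1"
      "\<And>i. p' i = e i * p i" "\<And>i. q' i = e i * q i"
    by metis
  have ee: "e i * e (i + 1) = 1" for i
  proof -
    have "e i * e (i + 1) * (p i * q (i + 1) - p (i + 1) * q i) = 1"
      using unimodular_seqD(3)[OF u(2), of i] unfolding e by (simp add: algebra_simps)
    then show ?thesis
      by (simp add: unimodular_seqD(3)[OF u(1)])
  qed
  obtain k where k: "e 0 = \<sigma> powi k"
    using eisenstein_unit_powi[OF e(1) e(2)] .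
  have "e i = \<sigma> powi (alt_sign i * k)" for i
  proof (induction i rule: int_shift_induct)
    case 1
    show ?case
      by (simp add: k alt_sign_def)
  next
    case (2 i)
    have "alt_sign (i + 1) * k = - (alt_sign i * k)"
      by (simp add: alt_sign_def)
    moreover have "e (i + 1) = inverse (e i)"
      using ee[of i] by (metis inverse_unique)
    ultimately show ?case
      by (simp add: power_int_minus)
  qed
  then show thesis
    using that e by metis
qed

section \<open>The matrix of a pair of paths\<close>

text \<open>Each 2x2 minor is the product of a determinant of consecutive \<open>(p, q)\<close> and
  one of consecutive \<open>(r, s)\<close>. The whole matrix has rank at most 2, so 3x3 determinants
  vanish.\<close>

lemma path_matrix_tame:
  assumes "unimodular_seq p q" "unimodular_seq r s"
  shows "path_matrix p q r s \<in> tame_SL2_tilings"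
proof -
  have "path_matrix p q r s i j \<in> eisenstein_ints" for i j
    unfolding path_matrix_def
    by (intro eisenstein_ints_closed unimodular_seqD[OF assms(1)] unimodular_seqD[OF assms(2)])
  moreover have "path_matrix p q r s i j * path_matrix p q r s (i + 1) (j + 1)
      - path_matrix p q r s i (j + 1) * path_matrix p q r s (i + 1) j = 1" for i j
    using unimodular_seqD(3)[OF assms(1), of i] unimodular_seqD(3)[OF assms(2), of j]
    unfolding path_matrix_def by algebra
  moreover have "tame (path_matrix p q r s)"
    unfolding tame_def det_3 path_matrix_def by (simp add: algebra_simps)
  ultimately show ?thesis
    by (simp add: tame_SL2_tilings_def SL2_tiling_def)
qed

text \<open>Applied to one pair of paths with two choices of normalisations, this also gives
  independence of the choice.\<close>

lemma path_pair_rel_imp_tiling_rel: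
  assumes n: "normalisation u p q" "normalisation v r s"
      "normalisation u' p' q'" "normalisation v' r' s'"
    and rel: "((u, v), (u', v')) \<in> path_pair_rel"
  shows "(path_matrix p q r s, path_matrix p' q' r' s') \<in> tiling_rel"
proof -
  have seq: "unimodular_seq p q" "unimodular_seq r s" "unimodular_seq p' q'" "unimodular_seq r' s'"
    using n by (auto simp: normalisation_iff)
  obtain A where A: "A \<in> SL2_eisenstein" "\<And>i. u' i = mobius A (u i)" "\<And>j. v' j = mobius A (v j)"
    using rel by (auto simp: path_pair_rel_def)
  have AE: "A $ i $ j \<in> eisenstein_ints" for i j
    using A(1) by (auto simp: SL2_eisenstein_def)
  have d: "A $ 1 $ 1 * A $ 2 $ 2 - A $ 1 $ 2 * A $ 2 $ 1 = 1"
    using A(1) by (simp add: SL2_eisenstein_def det_2)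
  \<comment> \<open>\<open>X\<close> and \<open>Y\<close> are the coordinates of the image under
    \<open>A\<close>. The image of a normalisation is a normalisation of the image path, so it
    differs from the given one by alternating powers of \<sigma>.\<close>
  define X where "X a b = (\<lambda>i::int. A $ 1 $ 1 * a i + A $ 1 $ 2 * b i)" for a b
  define Y where "Y a b = (\<lambda>i::int. A $ 2 $ 1 * a i + A $ 2 $ 2 * b i)" for a b
  have XY: "unimodular_seq (X a b) (Y a b)" if "unimodular_seq a b" for a b
  proof -
    have "X a b i * Y a b (i + 1) - X a b (i + 1) * Y a b i = 1" for i
      using d unimodular_seqD(3)[OF that, of i] unfolding X_def Y_def by algebra
    then show ?thesis
      unfolding unimodular_seq_def
      by (auto simp: X_def Y_def intro!: eisenstein_ints_closed AE unimodular_seqD[OF that])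
  qed
  have "fraction (X p q i) (Y p q i) = fraction (p' i) (q' i)" for i
    using n A(2)[of i] mobius_fraction[OF unimodular_nonzero[OF unimodular_seqD(4)[OF seq(1)]]]
    by (simp add: normalisation_iff X_def Y_def)
  then obtain k where k: "\<And>i. p' i = \<sigma> powi (alt_sign i * k) * X p q i"
    "\<And>i. q' i = \<sigma> powi (alt_sign i * k) * Y p q i"
    using unimodular_seq_unique[OF XY[OF seq(1)] seq(3)] by metis
  have "fraction (X r s i) (Y r s i) = fraction (r' i) (s' i)" for i
    using n A(3)[of i] mobius_fraction[OF unimodular_nonzero[OF unimodular_seqD(4)[OF seq(2)]]]
    by (simp add: normalisation_iff X_def Y_def)
  then obtain l where l: "\<And>i. r' i = \<sigma> powi (alt_sign i * l) * X r s i"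
    "\<And>i. s' i = \<sigma> powi (alt_sign i * l) * Y r s i"
    using unimodular_seq_unique[OF XY[OF seq(2)] seq(4)] by metis
  have "path_matrix p' q' r' s' i j
      = \<sigma> powi (alt_sign i * k + alt_sign j * l) * path_matrix p q r s i j" for i j
  proof -
    have "X p q i * Y r s j - Y p q i * X r s j = p i * s j - q i * r j"
      using d unfolding X_def Y_def by algebra
    then have "\<sigma> powi (alt_sign i * k) * \<sigma> powi (alt_sign j * l)
        * (X p q i * Y r s j - Y p q i * X r s j)
      = \<sigma> powi (alt_sign i * k) * \<sigma> powi (alt_sign j * l) * (p i * s j - q i * r j)"
      by simp
    then show ?thesis
      unfolding path_matrix_def k l by (simp add: power_int_add \<sigma>_nonzero algebra_simps)
  qed
  then show ?thesis
    using path_matrix_tame seq unfolding tiling_rel_def by blast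
qed

lemma eq_path_matrix_imp_SL2:
  assumes seq: "unimodular_seq p q" "unimodular_seq r s" "unimodular_seq p' q'" "unimodular_seq r' s'"
    and eq: "path_matrix p q r s = path_matrix p' q' r' s'"
  obtains A where "A \<in> SL2_eisenstein"
    "\<And>i. p' i = A $ 1 $ 1 * p i + A $ 1 $ 2 * q i" "\<And>i. q' i = A $ 2 $ 1 * p i + A $ 2 $ 2 * q i"
    "\<And>j. r' j = A $ 1 $ 1 * r j + A $ 1 $ 2 * s j" "\<And>j. s' j = A $ 2 $ 1 * r j + A $ 2 $ 2 * s j"
proof -
  \<comment> \<open>\<open>(a b; c d)\<close> maps the first two vectors of \<open>(p, q)\<close> to those of \<open>(p', q')\<close>.\<close>
  define a where "a = p' 0 * q 1 - p' 1 * q 0"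
  define b where "b = p' 1 * p 0 - p' 0 * p 1"
  define c where "c = q' 0 * q 1 - q' 1 * q 0"
  define d where "d = q' 1 * p 0 - q' 0 * p 1"
  have d0: "p 0 * q 1 - p 1 * q 0 = 1" "p' 0 * q' 1 - p' 1 * q' 0 = 1"
    "r' 0 * s' 1 - r' 1 * s' 0 = 1"
    using unimodular_seqD(3)[of _ _ 0] seq by fastforce+
  \<comment> \<open>The matrix is the product of the primed basis matrix with the inverse of the
    unprimed one, both of determinant 1.\<close>
  have det1: "a * d - b * c = 1"
    using d0 unfolding a_def b_def c_def d_def by algebra
  have base: "p' 0 = a * p 0 + b * q 0" "q' 0 = c * p 0 + d * q 0"
    "p' 1 = a * p 1 + b * q 1" "q' 1 = c * p 1 + d * q 1"
    using d0(1) unfolding a_def b_def c_def d_def by algebra+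
  have m: "p i * s j - q i * r j = p' i * s' j - q' i * r' j" for i j
    using eq unfolding path_matrix_def fun_eq_iff by blast
  \<comment> \<open>A vector is determined by its pairings with the vectors 0 and 1 of the primed
    first sequence. Both sides have the same pairings, because a matrix of determinant 1 preserves
    them. The next step exchanges the two sequences.\<close>
  have rs: "r' j = a * r j + b * s j" "s' j = c * r j + d * s j" for j
    using m[of 0 j] m[of 1 j] d0(2) det1 base by algebra+
  have pq: "p' i = a * p i + b * q i" "q' i = c * p i + d * q i" for i
    using m[of i 0] m[of i 1] d0(3) det1 rs[of 0] rs[of 1] by algebra+
  have E: "a \<in> eisenstein_ints" "b \<in> eisenstein_ints" "c \<in> eisenstein_ints" "d \<in> eisenstein_ints"
    unfolding a_def b_def c_def d_def
    by (intro eisenstein_ints_closed unimodular_seqD[OF seq(1)] unimodular_seqD[OF seq(3)])+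
  define A :: "complex^2^2" where "A = vector [vector [a, b], vector [c, d]]"
  have A: "A $ 1 $ 1 = a" "A $ 1 $ 2 = b" "A $ 2 $ 1 = c" "A $ 2 $ 2 = d"
    by (simp_all add: A_def)
  have "A \<in> SL2_eisenstein"
    using E det1 by (simp add: SL2_eisenstein_def forall_2 det_2 A)
  then show thesis
    using that[of A] rs pq unfolding A by blast
qed

text \<open>Exponents at consecutive indices are opposite, so the factors cancel in the
  determinant.\<close>

lemma unimodular_seq_rescale:
  assumes "unimodular_seq p q"
  shows "unimodular_seq (\<lambda>i. \<sigma> powi (alt_sign i * k) * p i) (\<lambda>i. \<sigma> powi (alt_sign i * k) * q i)"
proof -
  have s: "\<sigma> \<in> eisenstein_ints"
    by (rule eisenstein_intsI[of _ 0 1]) simp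
  have si: "inverse \<sigma> \<in> eisenstein_ints"
  proof -
    have "inverse \<sigma> = cnj \<sigma>"
      by (rule inverse_unique) (simp add: complex_norm_square[symmetric] cmod_\<sigma>)
    then show ?thesis
      using s eisenstein_ints_cnj by simp
  qed
  have pow: "x ^ n \<in> eisenstein_ints" if "x \<in> eisenstein_ints" for x n
    using that by (induction n) (auto intro: eisenstein_ints_closed)
  have powi: "\<sigma> powi z \<in> eisenstein_ints" for z
    unfolding power_int_def by (simp add: pow s si)
  have e: "\<sigma> powi (alt_sign i * k) * \<sigma> powi (alt_sign (i + 1) * k) = 1" for i
    by (simp add: power_int_add[symmetric] \<sigma>_nonzero alt_sign_def)
  have "\<sigma> powi (alt_sign i * k) * p i * (\<sigma> powi (alt_sign (i + 1) * k) * q (i + 1))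
      - \<sigma> powi (alt_sign (i + 1) * k) * p (i + 1) * (\<sigma> powi (alt_sign i * k) * q i) = 1" for i
    using e[of i] unimodular_seqD(3)[OF assms, of i] by algebra
  then show ?thesis
    unfolding unimodular_seq_def
    by (auto intro!: eisenstein_ints_mult powi unimodular_seqD[OF assms])
qed

text \<open>The factors relating the two tilings are absorbed into the normalisations,
  \<open>k\<close> into that of \<open>u\<close> and \<open>l\<close> into that of \<open>v\<close>.
  This leaves the vertices unchanged and makes the two matrices equal.\<close>

lemma tiling_rel_imp_path_pair_rel:
  assumes path: "(u, v) \<in> path_pairs" "(u', v') \<in> path_pairs"
    and n: "normalisation u p q" "normalisation v r s"
      "normalisation u' p' q'" "normalisation v' r' s'"
    and rel: "(path_matrix p q r s, path_matrix p' q' r' s') \<in> tiling_rel"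
  shows "((u, v), (u', v')) \<in> path_pair_rel"
proof -
  have seq: "unimodular_seq p q" "unimodular_seq r s" "unimodular_seq p' q'" "unimodular_seq r' s'"
    using n by (auto simp: normalisation_iff)
  obtain k l where kl: "\<And>i j. path_matrix p' q' r' s' i j
      = \<sigma> powi (alt_sign i * k + alt_sign j * l) * path_matrix p q r s i j"
    using rel by (auto simp: tiling_rel_def)
  let ?e = "\<lambda>k i. \<sigma> powi (alt_sign i * k)"
  have "path_matrix (\<lambda>i. ?e k i * p i) (\<lambda>i. ?e k i * q i) (\<lambda>i. ?e l i * r i) (\<lambda>i. ?e l i * s i)
      = path_matrix p' q' r' s'"
    by (intro ext, unfold kl) (simp add: path_matrix_def power_int_add \<sigma>_nonzero algebra_simps)
  then obtain A where A: "A \<in> SL2_eisenstein"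
    "\<And>i. p' i = A $ 1 $ 1 * (?e k i * p i) + A $ 1 $ 2 * (?e k i * q i)"
    "\<And>i. q' i = A $ 2 $ 1 * (?e k i * p i) + A $ 2 $ 2 * (?e k i * q i)"
    "\<And>i. r' i = A $ 1 $ 1 * (?e l i * r i) + A $ 1 $ 2 * (?e l i * s i)"
    "\<And>i. s' i = A $ 2 $ 1 * (?e l i * r i) + A $ 2 $ 2 * (?e l i * s i)"
    using eq_path_matrix_imp_SL2[OF unimodular_seq_rescale[OF seq(1)] unimodular_seq_rescale[OF seq(2)]
        seq(3,4)] by blast
  have mob: "mobius A (fraction x y)
      = fraction (A $ 1 $ 1 * (e * x) + A $ 1 $ 2 * (e * y)) (A $ 2 $ 1 * (e * x) + A $ 2 $ 2 * (e * y))"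
    if "unimodular x y" "e \<noteq> 0" for x y e
    using mobius_fraction[of "e * x" "e * y" A] unimodular_nonzero[OF that(1)] that(2)
    by (simp add: fraction_scale)
  have "u' i = mobius A (u i)" "v' i = mobius A (v i)" for i
    using n mob[OF unimodular_seqD(4)[OF seq(1)], of "?e k i" i]
      mob[OF unimodular_seqD(4)[OF seq(2)], of "?e l i" i] A
    by (simp_all add: normalisation_iff \<sigma>_nonzero)
  then show ?thesis
    using path A(1) unfolding path_pair_rel_def by blast
qed

section \<open>Reconstruction of a tame tiling\<close>

lemma int_two_step_induct:
  fixes P :: "int \<Rightarrow> bool"
  assumes "P 0" "P 1" "\<And>i. P i \<Longrightarrow> P (i + 1) \<Longrightarrow> P (i + 2)" "\<And>i. P (i + 1) \<Longrightarrow> P (i + 2) \<Longrightarrow> P i"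
  shows "P i"
proof -
  have "P i \<and> P (i + 1)"
    by (induction i rule: int_shift_induct) (use assms in \<open>auto simp: add.assoc\<close>)
  then show ?thesis ..
qed

lemma tame_SL2_tilingD:
  assumes "m \<in> tame_SL2_tilings"
  shows "m i j \<in> eisenstein_ints"
    "m i j * m (i + 1) (j + 1) - m i (j + 1) * m (i + 1) j = 1"
    "m i j * (m (i + 1) (j + 1) * m (i + 2) (j + 2) - m (i + 1) (j + 2) * m (i + 2) (j + 1))
     - m i (j + 1) * (m (i + 1) j * m (i + 2) (j + 2) - m (i + 1) (j + 2) * m (i + 2) j)
     + m i (j + 2) * (m (i + 1) j * m (i + 2) (j + 1) - m (i + 1) (j + 1) * m (i + 2) j) = 0"
proof -
  show "m i j \<in> eisenstein_ints" "m i j * m (i + 1) (j + 1) - m i (j + 1) * m (i + 1) j = 1"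
    using assms by (auto simp: tame_SL2_tilings_def SL2_tiling_def)
  have "tame m"
    using assms by (simp add: tame_SL2_tilings_def)
  then show "m i j * (m (i + 1) (j + 1) * m (i + 2) (j + 2) - m (i + 1) (j + 2) * m (i + 2) (j + 1))
     - m i (j + 1) * (m (i + 1) j * m (i + 2) (j + 2) - m (i + 1) (j + 2) * m (i + 2) j)
     + m i (j + 2) * (m (i + 1) j * m (i + 2) (j + 1) - m (i + 1) (j + 1) * m (i + 2) j) = 0"
    unfolding tame_def by (elim allE[of _ i] allE[of _ j]) (simp add: det_3 algebra_simps)
qed

text \<open>In a \<open>3\<times>3\<close> block each corner entry has cofactor 1, so it is determined by the others.\<close>

lemma tame_SL2_tiling_corners:
  assumes m: "m \<in> tame_SL2_tilings"
  shows "m i j = m i (j + 1) * (m (i + 1) j * m (i + 2) (j + 2) - m (i + 1) (j + 2) * m (i + 2) j)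
      - m i (j + 2) * (m (i + 1) j * m (i + 2) (j + 1) - m (i + 1) (j + 1) * m (i + 2) j)"
    and "m i (j + 2) = m i (j + 1) * (m (i + 1) j * m (i + 2) (j + 2) - m (i + 1) (j + 2) * m (i + 2) j)
      - m i j * (m (i + 1) (j + 1) * m (i + 2) (j + 2) - m (i + 1) (j + 2) * m (i + 2) (j + 1))"
    and "m (i + 2) j = m (i + 1) j * (m i (j + 1) * m (i + 2) (j + 2) - m i (j + 2) * m (i + 2) (j + 1))
      - m i j * (m (i + 1) (j + 1) * m (i + 2) (j + 2) - m (i + 1) (j + 2) * m (i + 2) (j + 1))"
    and "m (i + 2) (j + 2) = m (i + 1) (j + 2) * (m i j * m (i + 2) (j + 1) - m i (j + 1) * m (i + 2) j)
      - m i (j + 2) * (m (i + 1) j * m (i + 2) (j + 1) - m (i + 1) (j + 1) * m (i + 2) j)"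
proof -
  have minors: "m i j * m (i + 1) (j + 1) - m i (j + 1) * m (i + 1) j = 1"
    "m i (j + 1) * m (i + 1) (j + 2) - m i (j + 2) * m (i + 1) (j + 1) = 1"
    "m (i + 1) j * m (i + 2) (j + 1) - m (i + 1) (j + 1) * m (i + 2) j = 1"
    "m (i + 1) (j + 1) * m (i + 2) (j + 2) - m (i + 1) (j + 2) * m (i + 2) (j + 1) = 1"
    using tame_SL2_tilingD(2)[OF m, of i j] tame_SL2_tilingD(2)[OF m, of i "j + 1"]
      tame_SL2_tilingD(2)[OF m, of "i + 1" j] tame_SL2_tilingD(2)[OF m, of "i + 1" "j + 1"]
    by (simp_all add: add.assoc)
  note det = tame_SL2_tilingD(3)[OF m, of i j]
  show "m i j = m i (j + 1) * (m (i + 1) j * m (i + 2) (j + 2) - m (i + 1) (j + 2) * m (i + 2) j)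
      - m i (j + 2) * (m (i + 1) j * m (i + 2) (j + 1) - m (i + 1) (j + 1) * m (i + 2) j)"
    using det minors(4) by algebra
  show "m i (j + 2) = m i (j + 1) * (m (i + 1) j * m (i + 2) (j + 2) - m (i + 1) (j + 2) * m (i + 2) j)
      - m i j * (m (i + 1) (j + 1) * m (i + 2) (j + 2) - m (i + 1) (j + 2) * m (i + 2) (j + 1))"
    using det minors(3) by algebra
  show "m (i + 2) j = m (i + 1) j * (m i (j + 1) * m (i + 2) (j + 2) - m i (j + 2) * m (i + 2) (j + 1))
      - m i j * (m (i + 1) (j + 1) * m (i + 2) (j + 2) - m (i + 1) (j + 2) * m (i + 2) (j + 1))"
    using det minors(2) by algebra
  show "m (i + 2) (j + 2) = m (i + 1) (j + 2) * (m i j * m (i + 2) (j + 1) - m i (j + 1) * m (i + 2) j)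
      - m i (j + 2) * (m (i + 1) j * m (i + 2) (j + 1) - m (i + 1) (j + 1) * m (i + 2) j)"
    using det minors(1) by algebra
qed

text \<open>An outer induction over rows and an inner one over columns, each running in both
  directions, fill the plane from the given cross. The four combinations of directions solve for the
  four corners of a 3x3 block.\<close>

lemma tame_SL2_tiling_unique:
  assumes m: "m \<in> tame_SL2_tilings" and n: "n \<in> tame_SL2_tilings"
    and rows: "\<And>j. m 0 j = n 0 j" "\<And>j. m 1 j = n 1 j"
    and cols: "\<And>i. m i 0 = n i 0" "\<And>i. m i 1 = n i 1"
  shows "m = n"
proof -
  note cm = tame_SL2_tiling_corners[OF m] and cn = tame_SL2_tiling_corners[OF n]
  have "\<forall>j. m i j = n i j" for i
  proof (induction i rule: int_two_step_induct)
    case (3 i)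
    note IH = 3
    show ?case
    proof
      fix j show "m (i + 2) j = n (i + 2) j"
      proof (induction j rule: int_two_step_induct)
        case (3 j)
        then show ?case
          unfolding cm(4)[of i j] cn(4)[of i j] by (simp add: IH)
      next
        case (4 j)
        then show ?case
          unfolding cm(3)[of i j] cn(3)[of i j] by (simp add: IH)
      qed (use cols in auto)
    qed
  next
    case (4 i)
    note IH = 4
    show ?case
    proof
      fix j show "m i j = n i j"
      proof (induction j rule: int_two_step_induct)
        case (3 j)
        then show ?case
          unfolding cm(2)[of i j] cn(2)[of i j] by (simp add: IH)
      next
        case (4 j)
        then show ?case
          unfolding cm(1)[of i j] cn(1)[of i j] by (simp add: IH)
      qed (use cols in auto)
    qed
  qed (use rows in auto)
  then show ?thesis
    by (intro ext) blast
qed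

lemma tame_SL2_tiling_path_matrix:
  assumes m: "m \<in> tame_SL2_tilings"
  obtains p q r s where "unimodular_seq p q" "unimodular_seq r s" "m = path_matrix p q r s"
proof -
  \<comment> \<open>Normalised by \<open>(p\<^sub>0, q\<^sub>0) = (1, 0)\<close> and \<open>(p\<^sub>1, q\<^sub>1) = (0, 1)\<close>.\<close>
  define s where "s j = m 0 j" for j
  define r where "r j = - m 1 j" for j
  \<comment> \<open>Cramer's rule for the equations \<open>m i 0 = p i * s 0 - q i * r 0\<close> and
    \<open>m i 1 = p i * s 1 - q i * r 1\<close>.\<close>
  define p where "p i = r 0 * m i 1 - r 1 * m i 0" for i
  define q where "q i = s 0 * m i 1 - s 1 * m i 0" for i
  have d0: "m 0 j * m 1 (j + 1) - m 0 (j + 1) * m 1 j = 1" for j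
    using tame_SL2_tilingD(2)[OF m, of 0 j] by simp
  have d1: "m i 0 * m (i + 1) 1 - m i 1 * m (i + 1) 0 = 1" for i
    using tame_SL2_tilingD(2)[OF m, of i 0] by simp
  have d: "m 0 0 * m 1 1 - m 0 1 * m 1 0 = 1"
    using d0[of 0] by simp
  have rs: "unimodular_seq r s"
    unfolding unimodular_seq_def r_def s_def using d0
    by (auto intro: eisenstein_ints_closed tame_SL2_tilingD(1)[OF m] simp: algebra_simps)
  have "p i * q (i + 1) - p (i + 1) * q i = 1" for i
    using d d1[of i] unfolding p_def q_def r_def s_def by algebra
  then have pq: "unimodular_seq p q"
    unfolding unimodular_seq_def p_def q_def r_def s_def
    by (auto intro!: eisenstein_ints_closed tame_SL2_tilingD(1)[OF m])
  have "m = path_matrix p q r s"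
  proof (rule tame_SL2_tiling_unique[OF m path_matrix_tame[OF pq rs]])
    have p01: "p 0 = 1" "q 0 = 0" "p 1 = 0" "q 1 = 1"
      using d by (simp_all add: p_def q_def r_def s_def algebra_simps)
    show "m 0 j = path_matrix p q r s 0 j" "m 1 j = path_matrix p q r s 1 j" for j
      by (simp_all add: path_matrix_def p01 r_def s_def)
    show "m i 0 = path_matrix p q r s i 0" "m i 1 = path_matrix p q r s i 1" for i
      using d unfolding path_matrix_def p_def q_def r_def s_def by algebra+
  qed
  then show thesis
    using that pq rs by blast
qed

section \<open>The bijection\<close>

text \<open>The induced map sends a class to the saturation of its image, which avoids choosing a
  representative. Injectivity comes from \<open>f\<close> reflecting the relation, surjectivity from
  \<open>f\<close> meeting every class.\<close>

lemma quotient_bij_betw: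
  assumes R: "equiv A R" and S: "equiv B S"
    and into: "\<And>x. x \<in> A \<Longrightarrow> f x \<in> B"
    and rel: "\<And>x y. x \<in> A \<Longrightarrow> y \<in> A \<Longrightarrow> (x, y) \<in> R \<longleftrightarrow> (f x, f y) \<in> S"
    and onto: "\<And>y. y \<in> B \<Longrightarrow> \<exists>x\<in>A. (f x, y) \<in> S"
  shows "\<And>x. x \<in> A \<Longrightarrow> S `` (f ` (R `` {x})) = S `` {f x}"
    and "bij_betw (\<lambda>C. S `` (f ` C)) (A // R) (B // S)"
proof -
  show *: "S `` (f ` (R `` {x})) = S `` {f x}" if "x \<in> A" for x
  proof
    show "S `` {f x} \<subseteq> S `` (f ` (R `` {x}))"
      using equiv_class_self[OF R that] by blast
    show "S `` (f ` (R `` {x})) \<subseteq> S `` {f x}"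
    proof
      fix z assume "z \<in> S `` (f ` (R `` {x}))"
      then obtain y where y: "(x, y) \<in> R" "(f y, z) \<in> S"
        by blast
      then have "(f x, f y) \<in> S"
        using rel that R by (metis equiv_class_eq_iff)
      then show "z \<in> S `` {f x}"
        using y S by (meson Image_singleton_iff equivE transD)
    qed
  qed
  show "bij_betw (\<lambda>C. S `` (f ` C)) (A // R) (B // S)"
    unfolding bij_betw_def
  proof
    show "inj_on (\<lambda>C. S `` (f ` C)) (A // R)"
    proof (rule inj_onI)
      fix C D assume "C \<in> A // R" "D \<in> A // R" and eq: "S `` (f ` C) = S `` (f ` D)"
      then obtain x y where xy: "x \<in> A" "y \<in> A" "C = R `` {x}" "D = R `` {y}"
        by (auto elim!: quotientE)
      then have "(f x, f y) \<in> S"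
        using eq * into S by (simp add: eq_equiv_class)
      then show "C = D"
        using xy rel equiv_class_eq[OF R] by simp
    qed
    show "(\<lambda>C. S `` (f ` C)) ` (A // R) = B // S"
    proof
      show "(\<lambda>C. S `` (f ` C)) ` (A // R) \<subseteq> B // S"
        using * into by (auto elim!: quotientE simp: quotientI)
      show "B // S \<subseteq> (\<lambda>C. S `` (f ` C)) ` (A // R)"
      proof
        fix D assume "D \<in> B // S"
        then obtain y where y: "y \<in> B" "D = S `` {y}"
          by (auto elim!: quotientE)
        then obtain x where x: "x \<in> A" "(f x, y) \<in> S"
          using onto by blast
        then have "D = S `` (f ` (R `` {x}))"
          using y * equiv_class_eq[OF S] by simp
        then show "D \<in> (\<lambda>C. S `` (f ` C)) ` (A // R)"
          using x by (auto intro: quotientI)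
      qed
    qed
  qed
qed

theorem theorem5p20:
  shows "(\<forall>w. bi_infinite_path w \<longrightarrow> (\<exists>p q. normalisation w p q)) \<and>
    (\<exists>\<Phi>.
      (\<forall>u v p q r s.
         bi_infinite_path u \<longrightarrow> bi_infinite_path v \<longrightarrow>
         normalisation u p q \<longrightarrow> normalisation v r s \<longrightarrow>
         \<Phi> (path_pair_rel `` {(u, v)}) = tiling_rel `` {path_matrix p q r s}) \<and>
      bij_betw \<Phi> (path_pairs // path_pair_rel) (tame_SL2_tilings // tiling_rel))"
proof (intro conjI)
  show ex: "\<forall>w. bi_infinite_path w \<longrightarrow> (\<exists>p q. normalisation w p q)"
    using bi_infinite_path_normalisation by metis
  then obtain P Q where PQ: "\<And>w. bi_infinite_path w \<Longrightarrow> normalisation w (P w) (Q w)"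
    by metis
  define f where "f = (\<lambda>(u, v). path_matrix (P u) (Q u) (P v) (Q v))"
  \<comment> \<open>One side uses the chosen normalisations and the other arbitrary ones. Thus the
    same equivalence yields compatibility of \<open>f\<close> with the relations and independence of
    the normalisations.\<close>
  have rel: "(f x, path_matrix p q r s) \<in> tiling_rel \<longleftrightarrow> (x, (u, v)) \<in> path_pair_rel"
    if "x \<in> path_pairs" "(u, v) \<in> path_pairs" "normalisation u p q" "normalisation v r s"
    for x u v p q r s
    using that PQ path_pair_rel_imp_tiling_rel[of "fst x" "P (fst x)" "Q (fst x)"
        "snd x" "P (snd x)" "Q (snd x)" u p q v r s]
      tiling_rel_imp_path_pair_rel[of "fst x" "snd x" u v "P (fst x)" "Q (fst x)"
        "P (snd x)" "Q (snd x)" p q r s]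
    by (cases x) (auto simp: f_def path_pairs_def)
  have into: "f x \<in> tame_SL2_tilings" if "x \<in> path_pairs" for x
    using that PQ by (auto simp: f_def path_pairs_def normalisation_iff intro!: path_matrix_tame)
  have iff: "(x, y) \<in> path_pair_rel \<longleftrightarrow> (f x, f y) \<in> tiling_rel"
    if "x \<in> path_pairs" "y \<in> path_pairs" for x y
    using rel[OF that(1), of "fst y" "snd y"] that PQ
    by (cases y) (auto simp: f_def path_pairs_def)
  have onto: "\<exists>x\<in>path_pairs. (f x, m) \<in> tiling_rel" if m: "m \<in> tame_SL2_tilings" for m
  proof -
    obtain p q r s where *: "unimodular_seq p q" "unimodular_seq r s" "m = path_matrix p q r s"
      using tame_SL2_tiling_path_matrix[OF m] .
    let ?x = "(\<lambda>i. fraction (p i) (q i), \<lambda>j. fraction (r j) (s j))"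
    have x: "?x \<in> path_pairs"
      using * by (simp add: path_pairs_def bi_infinite_path_of_unimodular_seq)
    \<comment> \<open>The normalisations chosen for these paths may differ from \<open>p\<close>,
      \<open>q\<close>, \<open>r\<close>, \<open>s\<close>, so \<open>m\<close> is reached only up
      to equivalence.\<close>
    have "(f ?x, m) \<in> tiling_rel"
      unfolding *(3) using * equiv_path_pair_rel x
      by (subst rel[OF x x]) (auto simp: normalisation_iff equiv_def refl_on_def)
    then show ?thesis
      using x by blast
  qed
  have bij: "tiling_rel `` (f ` (path_pair_rel `` {x})) = tiling_rel `` {f x}" if "x \<in> path_pairs" for x
    by (rule quotient_bij_betw(1)[OF equiv_path_pair_rel equiv_tiling_rel])
      (use into iff onto that in blast)+
  have "tiling_rel `` (f ` (path_pair_rel `` {(u, v)})) = tiling_rel `` {path_matrix p q r s}"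
    if "bi_infinite_path u" "bi_infinite_path v" "normalisation u p q" "normalisation v r s"
    for u v p q r s
  proof -
    have x: "(u, v) \<in> path_pairs"
      using that by (simp add: path_pairs_def)
    have "(f (u, v), path_matrix p q r s) \<in> tiling_rel"
      using rel[OF x x] that equiv_path_pair_rel x by (auto simp: equiv_def refl_on_def)
    then show ?thesis
      using bij[OF x] equiv_class_eq[OF equiv_tiling_rel] by simp
  qed
  moreover have "bij_betw (\<lambda>C. tiling_rel `` (f ` C))
      (path_pairs // path_pair_rel) (tame_SL2_tilings // tiling_rel)"
    by (rule quotient_bij_betw(2)[OF equiv_path_pair_rel equiv_tiling_rel])
      (use into iff onto in blast)+
  ultimately show "\<exists>\<Phi>.
      (\<forall>u v p q r s.
         bi_infinite_path u \<longrightarrow> bi_infinite_path v \<longrightarrow>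
         normalisation u p q \<longrightarrow> normalisation v r s \<longrightarrow>
         \<Phi> (path_pair_rel `` {(u, v)}) = tiling_rel `` {path_matrix p q r s}) \<and>
      bij_betw \<Phi> (path_pairs // path_pair_rel) (tame_SL2_tilings // tiling_rel)"
    by (intro exI[of _ "\<lambda>C. tiling_rel `` (f ` C)"]) blast
qed

end
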